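(* Let $f=\min\{f_1,\dots,f_l\}$ for lower semicontinuous functions $f_i:\mathbb{R}^n\to\overline{\mathbb{R}}$ and let $\bar x\in\mathrm{dom}\,f$. Given a direction $(h,\nu)\in\mathbb{R}^n\times\mathbb{R}$, put $$I_0(\bar x,(h,\nu)):=\{i\in\{1,\dots,l\}\mid f(\bar x)=f_i(\bar x),\ \nu\in Df_i(\bar x)(h),\ \partial f_i(\bar x;(h,\nu))\neq\emptyset\}.$$ Then $$\partial f(\bar x;(h,\nu))\subset\bigcup_{i\in I_0(\bar x,(h,\nu))}\partial f_i(\bar x;(h,\nu)).$$
   Context: Euclidean norms are used; $t_k\downarrow0$ means $t_k>0$, $t_k\to0$; $\overline{\mathbb{R}}=\mathbb{R}\cup\{\pm\infty\}$. For $\Omega\subset\mathbb{R}^n$ and $x\in\Omega$: $T_\Omega(x)=\{u\mid\exists u_k\to u,\ t_k\downarrow0:\ x+t_ku_k\in\Omega\ \forall k\}$; $\hat N_\Omega(x)=\{\xi\mid\limsup_{x'\to x,\,x'\in\Omega}\langle\xi,x'-x\rangle/\|x'-x\|\le0\}$; both are empty if $x\notin\Omega$. The limiting normal cone in direction $u$ is $N_\Omega(x;u)=\{\xi\mid\exists t_k\downarrow0,\ u_k\to u,\ \xi_k\to\xi:\ \xi_k\in\hat N_\Omega(x+t_ku_k)\ \forall k\}$. For $f:\mathbb{R}^n\to\overline{\mathbb{R}}$: $\mathrm{dom}\,f=\{z\mid f(z)\in\mathbb{R}\}$; $\mathrm{epi}\,f=\{(z,\alpha)\in\mathbb{R}^{n+1}\mid\alpha\ge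 f(z)\}$; $\mathrm{gph}\,f=\{(z,f(z))\mid z\in\mathrm{dom}\,f\}$; for $x\in\mathrm{dom}\,f$, $Df(x)(u)=\{\mu\in\mathbb{R}\mid(u,\mu)\in T_{\mathrm{gph}\,f}(x,f(x))\}$ and, for $(u,\mu)\in\mathbb{R}^{n+1}$, $\partial f(x;(u,\mu))=\{\xi\mid(\xi,-1)\in N_{\mathrm{epi}\,f}((x,f(x));(u,\mu))\}$. *)

theory Defs
  imports "HOL-Analysis.Analysis"
begin

text \<open>
  The cones are defined over an arbitrary Euclidean space because they are used for
  \<open>\<real>\<^sup>n\<close> as well as for \<open>\<real>\<^sup>n \<times> \<real> = \<real>\<^sup>n\<^sup>+\<^sup>1\<close>; the product type carries the Euclidean norm.
\<close>

definition tangent_cone :: "'a::euclidean_space set \<Rightarrow> 'a \<Rightarrow> 'a set" where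
  "tangent_cone \<Omega> x = {u. x \<in> \<Omega> \<and>
     (\<exists>(u' :: nat \<Rightarrow> 'a) (t :: nat \<Rightarrow> real).
        u' \<longlonglongrightarrow> u \<and> (\<forall>k. t k > 0) \<and> t \<longlonglongrightarrow> 0 \<and> (\<forall>k. x + t k *\<^sub>R u' k \<in> \<Omega>))}"

text \<open>
  The punctured filter \<open>at x within \<Omega>\<close> leaves out \<open>x' = x\<close>, where the quotient is undefined.
  At an isolated point of \<open>\<Omega>\<close> the upper limit is \<open>-\<infinity>\<close>, so the cone is the whole space.
\<close>

definition regular_normal_cone :: "'a::euclidean_space set \<Rightarrow> 'a \<Rightarrow> 'a set" where
  "regular_normal_cone \<Omega> x = {\<xi>. x \<in> \<Omega> \<and>
     Limsup (at x within \<Omega>) (\<lambda>x'. ereal ((\<xi> \<bullet> (x' - x)) / norm (x' - x))) \<le> 0}"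

definition dir_limiting_normal_cone :: "'a::euclidean_space set \<Rightarrow> 'a \<Rightarrow> 'a \<Rightarrow> 'a set" where
  "dir_limiting_normal_cone \<Omega> x u = {\<xi>.
     \<exists>(t :: nat \<Rightarrow> real) (u' :: nat \<Rightarrow> 'a) (\<xi>' :: nat \<Rightarrow> 'a).
        (\<forall>k. t k > 0) \<and> t \<longlonglongrightarrow> 0 \<and> u' \<longlonglongrightarrow> u \<and> \<xi>' \<longlonglongrightarrow> \<xi> \<and>
        (\<forall>k. \<xi>' k \<in> regular_normal_cone \<Omega> (x + t k *\<^sub>R u' k))}"

definition dom_ereal :: "('a \<Rightarrow> ereal) \<Rightarrow> 'a set" where
  "dom_ereal f = {z. \<bar>f z\<bar> \<noteq> \<infinity>}"

definition epi_ereal :: "('a \<Rightarrow> ereal) \<Rightarrow> ('a \<times> real) set" where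
  "epi_ereal f = {(z, \<alpha>). ereal \<alpha> \<ge> f z}"

definition gph_ereal :: "('a \<Rightarrow> ereal) \<Rightarrow> ('a \<times> real) set" where
  "gph_ereal f = {(z, \<alpha>). z \<in> dom_ereal f \<and> ereal \<alpha> = f z}"

text \<open>
  Both derivatives below are meaningful for \<open>x \<in> dom f\<close> only, where \<open>real_of_ereal (f x)\<close> is
  the real number \<open>f x\<close>; outside the domain they are empty by convention.
\<close>

definition graphical_deriv :: "('a::euclidean_space \<Rightarrow> ereal) \<Rightarrow> 'a \<Rightarrow> 'a \<Rightarrow> real set" where
  "graphical_deriv f x u = {\<mu>. x \<in> dom_ereal f \<and>
     (u, \<mu>) \<in> tangent_cone (gph_ereal f) (x, real_of_ereal (f x))}"

definition dir_subdiff :: "('a::euclidean_space \<Rightarrow> ereal) \<Rightarrow> 'a \<Rightarrow> 'a \<times> real \<Rightarrow> 'a set" where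
  "dir_subdiff f x d = {\<xi>. x \<in> dom_ereal f \<and>
     (\<xi>, -1) \<in> dir_limiting_normal_cone (epi_ereal f) (x, real_of_ereal (f x)) d}"

definition lower_semicontinuous :: "('a::topological_space \<Rightarrow> ereal) \<Rightarrow> bool" where
  "lower_semicontinuous f \<longleftrightarrow> (\<forall>x. f x \<le> Liminf (at x) f)"

definition min_fun :: "(nat \<Rightarrow> 'a \<Rightarrow> ereal) \<Rightarrow> nat \<Rightarrow> 'a \<Rightarrow> ereal" where
  "min_fun f l x = Min ((\<lambda>i. f i x) ` {1..l})"

definition active_indices ::
  "(nat \<Rightarrow> 'a::euclidean_space \<Rightarrow> ereal) \<Rightarrow> nat \<Rightarrow> 'a \<Rightarrow> 'a \<times> real \<Rightarrow> nat set" where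
  "active_indices f l x d = {i \<in> {1..l}. min_fun f l x = f i x \<and>
     snd d \<in> graphical_deriv (f i) x (fst d) \<and> dir_subdiff (f i) x d \<noteq> {}}"

end

theory Submission
  imports Defs
begin

text \<open>
  Every normal \<open>(\<xi>, -1)\<close> in the directional limiting cone of \<open>epi f\<close> is a limit of regular
  normals \<open>(\<xi>\<^sub>k, -\<beta>\<^sub>k)\<close> at points \<open>(z\<^sub>k, \<alpha>\<^sub>k)\<close> of \<open>epi f\<close>, and \<open>\<beta>\<^sub>k > 0\<close> eventually. A regular
  normal that points strictly downwards can only sit on the graph, since otherwise one could
  descend vertically inside the epigraph (\<open>epi_normal_downward_imp_graph\<close>). Hence
  \<open>\<alpha>\<^sub>k = f z\<^sub>k\<close>, and as there are only finitely many pieces, a single \<open>f\<^sub>i\<close> attains the minimum at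
  \<open>z\<^sub>k\<close> for infinitely many \<open>k\<close>.

  That one subsequence delivers everything. As \<open>epi f\<^sub>i \<subseteq> epi f\<close> and the regular normal cone at a
  point grows when the set around it shrinks (\<open>regular_normal_cone_antimono\<close>), the \<open>(\<xi>\<^sub>k, -\<beta>\<^sub>k)\<close> are regular normals to
  \<open>epi f\<^sub>i\<close> at the same points. Lower semicontinuity of \<open>f\<^sub>i\<close> gives \<open>f\<^sub>i x \<le> lim \<alpha>\<^sub>k = f x\<close>, so
  \<open>f\<^sub>i\<close> is active at \<open>x\<close>; and since the points lie on the graph of \<open>f\<^sub>i\<close>, the difference quotients
  \<open>(\<alpha>\<^sub>k - f x) / t\<^sub>k \<longlonglongrightarrow> \<nu>\<close> witness that \<open>\<nu>\<close> belongs to the graphical derivative of \<open>f\<^sub>i\<close>.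
\<close>

text \<open>
  The condition on a regular normal is an upper bound over all nearby points of the set, so
  fewer points impose fewer constraints.
\<close>

lemma regular_normal_cone_antimono:
  assumes "A \<subseteq> B" and "p \<in> A"
  shows "regular_normal_cone B p \<subseteq> regular_normal_cone A p"
proof
  fix \<xi> assume "\<xi> \<in> regular_normal_cone B p"
  then have B: "Limsup (at p within B) (\<lambda>q. ereal ((\<xi> \<bullet> (q - p)) / norm (q - p))) \<le> 0"
    by (simp add: regular_normal_cone_def)
  have "at p within A \<le> at p within B"
    using assms(1) by (rule at_le)
  then have "Limsup (at p within A) (\<lambda>q. ereal ((\<xi> \<bullet> (q - p)) / norm (q - p))) \<le> 0"
    using B unfolding Limsup_le_iff by (meson filter_leD)
  then show "\<xi> \<in> regular_normal_cone A p"
    using assms(2) by (simp add: regular_normal_cone_def)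
qed

text \<open>
  If \<open>f z < \<alpha>\<close>, a short vertical descent from \<open>(z, \<alpha>)\<close> stays in the epigraph, and along it the
  normal quotient is constantly \<open>-c > 0\<close>, so its upper limit cannot be \<open>\<le> 0\<close>.
\<close>

lemma epi_normal_downward_imp_graph:
  fixes f :: "'a::euclidean_space \<Rightarrow> ereal"
  assumes normal: "(\<xi>, c) \<in> regular_normal_cone (epi_ereal f) (z, \<alpha>)" and "c < 0"
  shows "f z = ereal \<alpha>"
proof (rule ccontr)
  assume "f z \<noteq> ereal \<alpha>"
  moreover have "f z \<le> ereal \<alpha>"
    using normal by (simp add: regular_normal_cone_def epi_ereal_def)
  ultimately have above: "f z < ereal \<alpha>"
    by simp
  let ?q = "\<lambda>p. ((\<xi>, c) \<bullet> (p - (z, \<alpha>))) / norm (p - (z, \<alpha>))"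
  have "Limsup (at (z, \<alpha>) within epi_ereal f) (\<lambda>p. ereal (?q p)) \<le> 0"
    using normal by (simp add: regular_normal_cone_def)
  also have "0 < ereal (- c)"
    using \<open>c < 0\<close> by simp
  finally have "\<forall>\<^sub>F p in at (z, \<alpha>) within epi_ereal f. ereal (?q p) < ereal (- c)"
    by (rule Limsup_lessD)
  then obtain \<delta> where "\<delta> > 0"
    and small: "\<And>p. p \<in> epi_ereal f \<Longrightarrow> p \<noteq> (z, \<alpha>) \<Longrightarrow> dist p (z, \<alpha>) < \<delta> \<Longrightarrow> ?q p < - c"
    unfolding eventually_at by auto
  have "max (f z) (ereal (\<alpha> - \<delta>)) < ereal \<alpha>"
    using above \<open>\<delta> > 0\<close> by simp
  then obtain \<beta> where "max (f z) (ereal (\<alpha> - \<delta>)) < ereal \<beta>" "ereal \<beta> < ereal \<alpha>"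
    using ereal_dense2 by blast
  then have \<beta>: "f z < ereal \<beta>" "\<alpha> - \<delta> < \<beta>" "\<beta> < \<alpha>"
    by simp_all
  have "?q (z, \<beta>) < - c"
    using \<beta> by (intro small) (auto simp: epi_ereal_def dist_Pair_Pair dist_real_def)
  moreover have "?q (z, \<beta>) = - c"
    using \<beta> by (simp add: norm_Pair inner_Pair field_simps)
  ultimately show False
    by simp
qed

text \<open>
  Lower semicontinuity refers to the punctured neighbourhood filter, but the sequence may return
  to \<open>x\<close> itself; a strict lower bound for \<open>f x\<close> persists on a full neighbourhood.
\<close>

lemma lower_semicontinuous_le_lim:
  fixes f :: "'a::topological_space \<Rightarrow> ereal"
  assumes lsc: "lower_semicontinuous f"
    and z: "z \<longlonglongrightarrow> x" and lim: "(\<lambda>k. f (z k)) \<longlonglongrightarrow> L"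
  shows "f x \<le> L"
proof (rule dense_le)
  fix c assume "c < f x"
  moreover have "f x \<le> Liminf (at x) f"
    using lsc by (simp add: lower_semicontinuous_def)
  ultimately have "\<forall>\<^sub>F y in at x. c < f y"
    unfolding le_Liminf_iff by blast
  with \<open>c < f x\<close> have "\<forall>\<^sub>F y in nhds x. c < f y"
    by (auto simp: eventually_at_filter elim: eventually_mono)
  then have "\<forall>\<^sub>F k in sequentially. c < f (z k)"
    using z by (rule eventually_compose_filterlim)
  then show "c \<le> L"
    by (intro tendsto_lowerbound[OF lim]) (auto elim: eventually_mono)
qed

lemma min_fun_le: "i \<in> {1..l} \<Longrightarrow> min_fun f l x \<le> f i x"
  unfolding min_fun_def by (rule Min_le) auto

lemma min_fun_attained:
  assumes "l \<ge> 1"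
  shows "\<exists>i\<in>{1..l}. min_fun f l x = f i x"
proof -
  have "min_fun f l x \<in> (\<lambda>i. f i x) ` {1..l}"
    unfolding min_fun_def using assms by (intro Min_in) auto
  then show ?thesis
    by auto
qed

lemma finite_eventually_strict_mono_subseq:
  assumes "finite I" and "\<forall>\<^sub>F k in sequentially. \<exists>i\<in>I. P i k"
  shows "\<exists>i\<in>I. \<exists>r. strict_mono r \<and> (\<forall>k :: nat. P i (r k))"
proof -
  have "\<exists>\<^sub>F k in sequentially. \<exists>i\<in>I. P i k"
    using assms(2) by (simp add: eventually_frequently)
  from frequently_bex_finite[OF assms(1) this]
  obtain i where "i \<in> I" and "\<exists>\<^sub>F k in sequentially. P i k" ..
  then have inf: "infinite {k. P i k}"
    by (simp add: frequently_cofinite cofinite_eq_sequentially[symmetric])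
  show ?thesis
    using \<open>i \<in> I\<close> strict_mono_enumerate[OF inf] enumerate_in_set[OF inf]
    by (intro bexI[of _ i] exI[of _ "enumerate {k. P i k}"]) auto
qed

theorem proposition4p4:
  fixes f :: "nat \<Rightarrow> real ^ 'n \<Rightarrow> ereal" and l :: nat
    and x :: "real ^ 'n" and h :: "real ^ 'n" and \<nu> :: real
  assumes "l \<ge> 1"
    and "\<And>i. i \<in> {1..l} \<Longrightarrow> lower_semicontinuous (f i)"
    and "x \<in> dom_ereal (min_fun f l)"
  shows "dir_subdiff (min_fun f l) x (h, \<nu>)
           \<subseteq> (\<Union>i \<in> active_indices f l x (h, \<nu>). dir_subdiff (f i) x (h, \<nu>))"
proof
  fix \<xi> assume \<xi>: "\<xi> \<in> dir_subdiff (min_fun f l) x (h, \<nu>)"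
  define g where "g = min_fun f l"
  define y where "y = real_of_ereal (g x)"
  have gx: "g x = ereal y"
    using assms(3) by (simp add: dom_ereal_def g_def y_def ereal_real)
  obtain t u \<eta> where t0: "\<And>k. t k > 0" and t: "t \<longlonglongrightarrow> 0"
    and u: "u \<longlonglongrightarrow> (h, \<nu>)" and \<eta>: "\<eta> \<longlonglongrightarrow> (\<xi>, -1)"
    and normal: "\<And>k. \<eta> k \<in> regular_normal_cone (epi_ereal g) ((x, y) + t k *\<^sub>R u k)"
    using \<xi> unfolding dir_subdiff_def dir_limiting_normal_cone_def g_def[symmetric] y_def[symmetric]
    by blast
  define z \<alpha> where "z k = x + t k *\<^sub>R fst (u k)" and "\<alpha> k = y + t k * snd (u k)" for k
  have pt: "(x, y) + t k *\<^sub>R u k = (z k, \<alpha> k)" for k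
    by (simp add: z_def \<alpha>_def prod_eq_iff)
  have "(\<lambda>k. snd (\<eta> k)) \<longlonglongrightarrow> - 1"
    using tendsto_snd[OF \<eta>] by simp
  then have "\<forall>\<^sub>F k in sequentially. snd (\<eta> k) < 0"
    by (rule order_tendstoD) simp
  then have "\<forall>\<^sub>F k in sequentially. \<exists>i\<in>{1..l}. f i (z k) = ereal (\<alpha> k)"
  proof (rule eventually_mono)
    fix k assume "snd (\<eta> k) < 0"
    then have "g (z k) = ereal (\<alpha> k)"
      using normal[of k] epi_normal_downward_imp_graph[of "fst (\<eta> k)" "snd (\<eta> k)"]
      by (simp add: pt)
    then show "\<exists>i\<in>{1..l}. f i (z k) = ereal (\<alpha> k)"
      using min_fun_attained[OF assms(1), of f "z k"] by (auto simp: g_def)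
  qed
  from finite_eventually_strict_mono_subseq[OF finite_atLeastAtMost this]
  obtain i and r :: "nat \<Rightarrow> nat" where i: "i \<in> {1..l}" and r: "strict_mono r"
    and on_graph: "\<And>k. f i (z (r k)) = ereal (\<alpha> (r k))"
    by blast
  have sub: "(\<lambda>k. t (r k)) \<longlonglongrightarrow> 0" "(\<lambda>k. u (r k)) \<longlonglongrightarrow> (h, \<nu>)" "(\<lambda>k. \<eta> (r k)) \<longlonglongrightarrow> (\<xi>, -1)"
    using t u \<eta> LIMSEQ_subseq_LIMSEQ[OF _ r] by (auto simp: o_def)
  have "(\<lambda>k. z (r k)) \<longlonglongrightarrow> x + 0 *\<^sub>R h"
    unfolding z_def using sub tendsto_fst[OF sub(2)] by (intro tendsto_intros) auto
  then have z_lim: "(\<lambda>k. z (r k)) \<longlonglongrightarrow> x"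
    by simp
  have "(\<lambda>k. \<alpha> (r k)) \<longlonglongrightarrow> y + 0 * \<nu>"
    unfolding \<alpha>_def using sub tendsto_snd[OF sub(2)] by (intro tendsto_intros) auto
  then have "(\<lambda>k. f i (z (r k))) \<longlonglongrightarrow> ereal y"
    by (simp add: on_graph)
  then have "f i x \<le> g x"
    using lower_semicontinuous_le_lim[OF assms(2)[OF i] z_lim] by (simp add: gx)
  then have fx: "f i x = ereal y"
    using min_fun_le[OF i, of f x] gx by (simp add: g_def)
  then have dom: "x \<in> dom_ereal (f i)"
    by (simp add: dom_ereal_def)
  then have base: "(x, y) \<in> gph_ereal (f i)"
    by (simp add: gph_ereal_def fx)
  have "(x, y) + t (r k) *\<^sub>R u (r k) \<in> gph_ereal (f i)" for k
    by (simp add: pt gph_ereal_def dom_ereal_def on_graph)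
  then have "\<nu> \<in> graphical_deriv (f i) x h"
    using base dom sub t0 unfolding graphical_deriv_def tangent_cone_def
    by (auto simp: fx intro!: exI[of _ "\<lambda>k. u (r k)"] exI[of _ "\<lambda>k. t (r k)"])
  moreover have "\<eta> (r k) \<in> regular_normal_cone (epi_ereal (f i)) ((x, y) + t (r k) *\<^sub>R u (r k))" for k
  proof -
    have "epi_ereal (f i) \<subseteq> epi_ereal g"
      using min_fun_le[OF i, of f] by (auto simp: epi_ereal_def g_def intro: order_trans)
    moreover have "(z (r k), \<alpha> (r k)) \<in> epi_ereal (f i)"
      by (simp add: epi_ereal_def on_graph)
    ultimately show ?thesis
      using regular_normal_cone_antimono normal[of "r k"] unfolding pt by blast
  qed
  then have "(\<xi>, -1) \<in> dir_limiting_normal_cone (epi_ereal (f i)) (x, y) (h, \<nu>)"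
    unfolding dir_limiting_normal_cone_def
    by (intro CollectI exI[where x = "\<lambda>k. t (r k)"] exI[where x = "\<lambda>k. u (r k)"]
        exI[where x = "\<lambda>k. \<eta> (r k)"] conjI allI sub t0)
  then have "\<xi> \<in> dir_subdiff (f i) x (h, \<nu>)"
    using dom by (simp add: dir_subdiff_def fx)
  ultimately show "\<xi> \<in> (\<Union>i \<in> active_indices f l x (h, \<nu>). dir_subdiff (f i) x (h, \<nu>))"
    using i fx gx by (auto simp: active_indices_def g_def)
qed

end
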